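(* Let $V=(A,B,C,a,b,c)\in F^6$ with $D\langle V\rangle=B^2-4AC\neq 0$, and consider the equation $A(\partial^1)^2u+B\partial^1\partial^2u+C(\partial^2)^2u+a\partial^1u+b\partial^2u+cu=0$. Suppose that $$\partial^2\frac{a^{\partial}\langle V\rangle}{D\langle V\rangle}=\partial^1\frac{b^{\partial}\langle V\rangle}{D\langle V\rangle}\quad\text{and}\quad \gamma_0^{\partial}\langle V\rangle\neq 0 .$$ Then the equation is $G$-equivalent to a linear partial differential equation with constant coefficients if and only if the system $$(\partial^ig\,g^{-1})^tM^{\partial}\langle V\rangle+M^{\partial}\langle V\rangle\,\partial^ig\,g^{-1}+\partial^iM^{\partial}\langle V\rangle=0,\quad i=1,2,$$ $$\partial^ig\,g^{-1}\,m^{\partial}\langle V\rangle=\partial^im^{\partial}\langle V\rangle,\quad i=1,2,$$ has a solution $g\in GL^{\partial}(2,F)$, where $$M^{\partial}\langle V\rangle=\frac{1}{\gamma_0^{\partial}\langle V\rangle}\begin{pmatrix} A & B/2 \\ B/2 & C \end{pmatrix},\qquad m^{\partial}\langle V\rangle=\begin{pmatrix}\frac{a^{\partial}\langle V\rangle}{D\langle V\rangle}+\gamma_0^{\partial}\langle V\rangle^{-1}\partial^1\gamma_0^{\partial}\langle V\rangle\\[2pt] \frac{b^{\partial}\langle V\rangle}{D\langle V\rangle}+\gamma_0^{\partial}\langle V\rangle^{-1}\partial^2\gamma_0^{\partial}\langle V\rangle\end{pmatrix}.$$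
   Context: $(F,\partial^1,\partial^2)$ is a field of characteristic different from 2 with two commuting derivations, linearly independent over $F$; $\partial$ is the column $(\partial^1,\partial^2)^t$; derivations act on matrices entrywise; $t$ is transpose. Subscripts $x,y$ denote $\partial^1,\partial^2$: $u_x=\partial^1u$, $u_y=\partial^2u$. The constant field is $\{f\in F:\partial^1f=\partial^2f=0\}$ (not to be confused with the coefficient $C$). $GL^{\partial}(2,F)=\{g=(g^i_j)\in GL(2,F):\partial^kg^i_j=\partial^ig^k_j,\ i,j,k=1,2\}$, with $g^i_j$ in row $i$, column $j$. For $V=(A,B,C,a,b,c)\in F^6$, $h\in F^*=F\setminus\{0\}$, $g\in GL^{\partial}(2,F)$, define $V_1=\tau^{\partial}\langle h,g;V\rangle=(A_1,B_1,C_1,a_1,b_1,c_1)$ by $$\begin{aligned} A_1&=h(A(g^1_1)^2+Bg^1_1g^2_1+C(g^2_1)^2),\\ B_1&=h(2Ag^1_1g^1_2+B(g^1_1g^2_2+g^1_2g^2_1)+2Cg^2_1g^2_2),\\ C_1&=h(A(g^1_2)^2+Bg^1_2g^2_2+C(g^2_2)^2),\\ a_1&=h(A\partial^1g^1_1+B\partial^1g^2_1+C\partial^2g^2_1+ag^1_1+bg^2_1)+2A\,\partial^1h\,g^1_1+B(\partial^1h\,g^2_1+\partial^2h\,g^1_1)+2C\,\partial^2h\,g^2_1,\\ b_1&=h(A\partial^1g^1_2+B\partial^1g^2_2+C\partial^2g^2_2+ag^1_2+bg^2_2)+2A\,\partial^1h\,g^1_2+B(\partial^1h\,g^2_2+\partial^2h\,g^1_2)+2C\,\partial^2h\,g^2_2,\\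 c_1&=A(\partial^1)^2h+B\partial^1\partial^2h+C(\partial^2)^2h+a\,\partial^1h+b\,\partial^2h+ch. \end{aligned}$$ (These are the coefficients of the equation in $v=h^{-1}u$ with respect to the derivations $\delta=g^{-1}\partial$.) The equation with coefficients $V$ is $G$-equivalent ($G=F^*\times GL^{\partial}(2,F)$) to the equation $A_1(\delta^1)^2v+B_1\delta^1\delta^2v+C_1(\delta^2)^2v+a_1\delta^1v+b_1\delta^2v+c_1v=0$ if $\delta=g^{-1}\partial$ and $V_1=\tau^{\partial}\langle h,g;V\rangle$ for some $h\in F^*$, $g\in GL^\partial(2,F)$. It has constant coefficients if all components of $V_1$ lie in the constant field. Further notation: $$\begin{aligned} D\langle V\rangle&=B^2-4AC,\\ a^{\partial}\langle V\rangle&=AC_x-A_xC+BC_y-B_yC-bB+2aC,\\ b^{\partial}\langle V\rangle&=A_xB-AB_x+A_yC-AC_y-aB+2bA, \end{aligned}$$ and, with $p=\frac{a^{\partial}\langle V\rangle}{D\langle V\rangle}$, $q=\frac{b^{\partial}\langle V\rangle}{D\langle V\rangle}$, $$\gamma_0^{\partial}\langle V\rangle=A(p_x+p^2)+B(p_y+pq)+C(q_y+q^2)+ap+bq+c .$$ *)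

theory Defs
  imports "HOL-Analysis.Analysis"
begin

definition derivation :: "('a::ring \<Rightarrow> 'a) \<Rightarrow> bool" where
  "derivation D \<longleftrightarrow>
     (\<forall>u v. D (u + v) = D u + D v) \<and> (\<forall>u v. D (u * v) = D u * v + u * D v)"

text \<open>A column of two derivations is a function \<open>d\<close> on the two-element index type \<open>2\<close>:
  \<open>d 1\<close> is \<open>\<partial>\<^sup>1\<close> (subscript \<open>x\<close>) and \<open>d 2\<close> is \<open>\<partial>\<^sup>2\<close> (subscript \<open>y\<close>).
  The entry \<open>g\<^sup>i\<^sub>j\<close> of a matrix is \<open>g $ i $ j\<close>.\<close>

type_synonym 'a derivs = "2 \<Rightarrow> 'a \<Rightarrow> 'a"

definition lin_indep_derivs :: "'a::field derivs \<Rightarrow> bool" where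
  "lin_indep_derivs d \<longleftrightarrow>
     (\<forall>s t. (\<forall>u. s * d 1 u + t * d 2 u = 0) \<longrightarrow> s = 0 \<and> t = 0)"

definition constant_field :: "'a::field derivs \<Rightarrow> 'a set" where
  "constant_field d = {f. d 1 f = 0 \<and> d 2 f = 0}"

definition GL_d :: "'a::field derivs \<Rightarrow> ('a^2^2) set" where
  "GL_d d = {g. invertible g \<and> (\<forall>i j k. d k (g $ i $ j) = d i (g $ k $ j))}"

text \<open>The tuple \<open>V = (A, B, C, a, b, c)\<close>. A pair \<open>(d, V)\<close> stands for the equation
  \<open>A (\<partial>\<^sup>1)\<^sup>2 u + B \<partial>\<^sup>1 \<partial>\<^sup>2 u + C (\<partial>\<^sup>2)\<^sup>2 u + a \<partial>\<^sup>1 u + b \<partial>\<^sup>2 u + c u = 0\<close>.\<close>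

type_synonym 'a coeffs = "'a \<times> 'a \<times> 'a \<times> 'a \<times> 'a \<times> 'a"

type_synonym 'a pde = "'a derivs \<times> 'a coeffs"

fun tau :: "'a::field derivs \<Rightarrow> 'a \<Rightarrow> 'a^2^2 \<Rightarrow> 'a coeffs \<Rightarrow> 'a coeffs" where
  "tau d h g (A, B, C, a, b, c) =
    (h * (A * (g$1$1)^2 + B * g$1$1 * g$2$1 + C * (g$2$1)^2),
     h * (2 * A * g$1$1 * g$1$2 + B * (g$1$1 * g$2$2 + g$1$2 * g$2$1) + 2 * C * g$2$1 * g$2$2),
     h * (A * (g$1$2)^2 + B * g$1$2 * g$2$2 + C * (g$2$2)^2),
     h * (A * d 1 (g$1$1) + B * d 1 (g$2$1) + C * d 2 (g$2$1) + a * g$1$1 + b * g$2$1)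
       + 2 * A * d 1 h * g$1$1 + B * (d 1 h * g$2$1 + d 2 h * g$1$1) + 2 * C * d 2 h * g$2$1,
     h * (A * d 1 (g$1$2) + B * d 1 (g$2$2) + C * d 2 (g$2$2) + a * g$1$2 + b * g$2$2)
       + 2 * A * d 1 h * g$1$2 + B * (d 1 h * g$2$2 + d 2 h * g$1$2) + 2 * C * d 2 h * g$2$2,
     A * d 1 (d 1 h) + B * d 1 (d 2 h) + C * d 2 (d 2 h) + a * d 1 h + b * d 2 h + c * h)"

text \<open>\<open>g\<^sup>-\<^sup>1 \<partial>\<close>, the matrix \<open>g\<^sup>-\<^sup>1\<close> applied to the column of derivations.\<close>

definition transform_derivs :: "'a::field^2^2 \<Rightarrow> 'a derivs \<Rightarrow> 'a derivs" where
  "transform_derivs g d = (\<lambda>i u. \<Sum>j\<in>UNIV. matrix_inv g $ i $ j * d j u)"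

fun G_equivalent :: "'a::field pde \<Rightarrow> 'a pde \<Rightarrow> bool" where
  "G_equivalent (d, V) (\<delta>, V1) \<longleftrightarrow>
     (\<exists>h g. h \<noteq> 0 \<and> g \<in> GL_d d \<and> \<delta> = transform_derivs g d \<and> V1 = tau d h g V)"

text \<open>Constancy is with respect to the original derivations \<open>d\<close>, also for an equation written
  in other derivations.\<close>

fun constant_coeffs :: "'a::field derivs \<Rightarrow> 'a coeffs \<Rightarrow> bool" where
  "constant_coeffs d (A, B, C, a, b, c) \<longleftrightarrow> {A, B, C, a, b, c} \<subseteq> constant_field d"

fun disc :: "'a::field coeffs \<Rightarrow> 'a" where
  "disc (A, B, C, a, b, c) = B^2 - 4 * A * C"

fun a_d :: "'a::field derivs \<Rightarrow> 'a coeffs \<Rightarrow> 'a" where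
  "a_d d (A, B, C, a, b, c) =
     A * d 1 C - d 1 A * C + B * d 2 C - d 2 B * C - b * B + 2 * a * C"

fun b_d :: "'a::field derivs \<Rightarrow> 'a coeffs \<Rightarrow> 'a" where
  "b_d d (A, B, C, a, b, c) =
     d 1 A * B - A * d 1 B + d 2 A * C - A * d 2 C - a * B + 2 * b * A"

fun gamma0 :: "'a::field derivs \<Rightarrow> 'a coeffs \<Rightarrow> 'a" where
  "gamma0 d (A, B, C, a, b, c) =
     (let p = a_d d (A, B, C, a, b, c) / disc (A, B, C, a, b, c);
          q = b_d d (A, B, C, a, b, c) / disc (A, B, C, a, b, c)
      in A * (d 1 p + p^2) + B * (d 2 p + p * q) + C * (d 2 q + q^2) + a * p + b * q + c)"

fun M_d :: "'a::field derivs \<Rightarrow> 'a coeffs \<Rightarrow> 'a^2^2" where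
  "M_d d (A, B, C, a, b, c) =
     map_matrix ((*) (1 / gamma0 d (A, B, C, a, b, c)))
       (vector [vector [A, B / 2], vector [B / 2, C]])"

definition m_d :: "'a::field derivs \<Rightarrow> 'a coeffs \<Rightarrow> 'a^2" where
  "m_d d V = vector
     [a_d d V / disc V + inverse (gamma0 d V) * d 1 (gamma0 d V),
      b_d d V / disc V + inverse (gamma0 d V) * d 2 (gamma0 d V)]"

definition map_vector :: "('a \<Rightarrow> 'b) \<Rightarrow> 'a^'n \<Rightarrow> 'b^'n" where
  "map_vector f v = (\<chi> i. f (v $ i))"

end

theory Submission
  imports Defs
begin

text \<open>
  The action of \<open>(h, g)\<close> is the substitution \<open>u = h v\<close> followed by the change of derivations
  \<open>\<partial> = g \<delta>\<close>. Write \<open>p, q\<close> for \<open>a\<^sup>\<partial> / D\<close>, \<open>b\<^sup>\<partial> / D\<close>. The substitution changes \<open>(p, q)\<close> to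
  \<open>(p, q) - \<partial>h / h\<close> and \<open>\<gamma>\<^sub>0\<close> to \<open>h \<gamma>\<^sub>0\<close>, so that \<open>M\<close> and \<open>m\<close> are invariant; the change of
  derivations replaces \<open>(p, q)\<close> by \<open>g\<^sup>-\<^sup>1 (p, q)\<close>, keeps \<open>\<gamma>\<^sub>0\<close> and turns \<open>M\<close> into \<open>g\<^sup>t M g\<close>. The
  system of the theorem says that \<open>g\<^sup>t M g\<close> and \<open>g\<^sup>-\<^sup>1 m\<close> are constant, which is clear if the
  transformed equation has constant coefficients. Conversely, the choice \<open>h = 1 / \<gamma>\<^sub>0\<close> normalizes
  \<open>\<gamma>\<^sub>0\<close> to 1; then \<open>g\<^sup>t M g\<close> and \<open>g\<^sup>-\<^sup>1 m\<close> are the principal part and \<open>(p, q)\<close> of the transformed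
  equation, and together with \<open>\<gamma>\<^sub>0 = 1\<close> they determine its lower-order coefficients rationally.
\<close>

text \<open>With \<open>p = \<partial>\<^sup>1w / w\<close> and \<open>q = \<partial>\<^sup>2w / w\<close> this is \<open>L w / w\<close> for the operator \<open>L\<close> with
  coefficients \<open>V\<close>, which explains its behaviour under the group.\<close>

fun riccati :: "'a::field derivs \<Rightarrow> 'a coeffs \<Rightarrow> 'a \<Rightarrow> 'a \<Rightarrow> 'a" where
  "riccati d (A, B, C, a, b, c) p q =
     A * (d 1 p + p\<^sup>2) + B * (d 2 p + p * q) + C * (d 2 q + q\<^sup>2) + a * p + b * q + c"

lemma gamma0_eq_riccati:
  "gamma0 d V = riccati d V (a_d d V / disc V) (b_d d V / disc V)"
  by (cases V) (simp add: Let_def)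

section \<open>Preliminaries on the discriminant and on matrix inverses\<close>

lemma disc_tau_left: "disc (tau d h (mat 1) V) = h\<^sup>2 * disc V"
  by (cases V) (simp add: mat_def power2_eq_square algebra_simps)

lemma disc_tau_right:
  assumes "\<And>i. d i 1 = 0"
  shows "disc (tau d 1 g V) = (det g)\<^sup>2 * disc V"
proof -
  obtain A B C a b c where V: "V = (A, B, C, a, b, c)"
    by (metis prod_cases6)
  show ?thesis
    unfolding V tau.simps disc.simps det_2 by algebra
qed

lemma matrix_add_rdistrib: "(A + B) ** C = A ** C + B ** C"
  by (vector matrix_matrix_mult_def sum.distrib[symmetric] field_simps)

lemma matrix_inv_inverse:
  fixes g :: "'a::semiring_1^'n^'m"
  assumes "invertible g"
  shows "g ** matrix_inv g = mat 1" and "matrix_inv g ** g = mat 1"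
  using someI_ex[OF assms[unfolded invertible_def]] by (simp_all add: matrix_inv_def)

section \<open>Calculus of derivations and the field of constants\<close>

locale commuting_derivations =
  fixes d :: "'a::field derivs"
  assumes derivation_d: "derivation (d i)"
    and commute: "d 1 (d 2 u) = d 2 (d 1 u)"
begin

lemma d_add [simp]: "d i (u + v) = d i u + d i v"
  using derivation_d[of i] by (simp add: derivation_def)

lemma d_mult [simp]: "d i (u * v) = d i u * v + u * d i v"
  using derivation_d[of i] by (simp add: derivation_def)

lemma d_0 [simp]: "d i 0 = 0"
  using d_add[of i 0 0] by (metis add_cancel_right_right)

lemma d_1 [simp]: "d i 1 = 0"
  using d_mult[of i 1 1] by (metis add_cancel_right_right mult.right_neutral mult_1)

lemma d_minus [simp]: "d i (- u) = - d i u"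
  using d_add[of i u "- u"] by (simp add: eq_neg_iff_add_eq_0 add.commute)

lemma d_diff [simp]: "d i (u - v) = d i u - d i v"
  using d_add[of i u "- v"] by simp

lemma d_of_nat [simp]: "d i (of_nat n) = 0"
  by (induction n) auto

lemma d_numeral [simp]: "d i (numeral n) = 0"
  using d_of_nat[of i "numeral n"] by simp

lemma d_power2 [simp]: "d i (u\<^sup>2) = 2 * u * d i u"
  by (simp add: power2_eq_square algebra_simps)

lemma d_divide:
  assumes "v \<noteq> 0"
  shows "d i (u / v) = (d i u - (u / v) * d i v) / v"
proof -
  have "d i u = d i (u / v) * v + (u / v) * d i v"
    using d_mult[of i "u / v" v] assms by simp
  then show ?thesis
    using assms by (simp add: field_simps)
qed

lemma d_sum [simp]: "d i (sum f S) = (\<Sum>x\<in>S. d i (f x))"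
  by (induction S rule: infinite_finite_induct) auto

lemma constant_iff: "x \<in> constant_field d \<longleftrightarrow> (\<forall>i. d i x = 0)"
  by (simp add: constant_field_def forall_2)

lemma constant_add: "x \<in> constant_field d \<Longrightarrow> y \<in> constant_field d \<Longrightarrow> x + y \<in> constant_field d"
  and constant_diff: "x \<in> constant_field d \<Longrightarrow> y \<in> constant_field d \<Longrightarrow> x - y \<in> constant_field d"
  and constant_minus: "x \<in> constant_field d \<Longrightarrow> - x \<in> constant_field d"
  and constant_mult: "x \<in> constant_field d \<Longrightarrow> y \<in> constant_field d \<Longrightarrow> x * y \<in> constant_field d"
  and constant_divide: "x \<in> constant_field d \<Longrightarrow> y \<in> constant_field d \<Longrightarrow> x / y \<in> constant_field d"
  and constant_0: "0 \<in> constant_field d"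
  and constant_1: "1 \<in> constant_field d"
  and constant_numeral: "numeral n \<in> constant_field d"
  and constant_power2: "x \<in> constant_field d \<Longrightarrow> x\<^sup>2 \<in> constant_field d"
  \<comment> \<open>The quotient needs the split because \<open>x / 0\<close> is 0 by
    convention.\<close>
  by (auto simp: constant_iff, cases "y = 0", auto simp: d_divide)

lemmas constant_intros = constant_add constant_diff constant_minus constant_mult constant_divide
  constant_0 constant_1 constant_numeral constant_power2

section \<open>The system as constancy of a matrix and of a vector\<close>

lemma d_matrix_mult:
  "map_matrix (d i) (X ** Y) = map_matrix (d i) X ** Y + X ** map_matrix (d i) Y"
  by (simp add: vec_eq_iff matrix_matrix_mult_def map_matrix_def sum.distrib)

lemma d_matrix_vector_mult:
  "map_vector (d i) (X *v u) = map_matrix (d i) X *v u + X *v map_vector (d i) u"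
  by (simp add: vec_eq_iff matrix_vector_mult_def map_matrix_def map_vector_def sum.distrib)

lemma d_transpose: "map_matrix (d i) (transpose X) = transpose (map_matrix (d i) X)"
  by (simp add: vec_eq_iff transpose_def map_matrix_def)

text \<open>Since \<open>X ** g = map_matrix (d i) g\<close>, the product rule turns the derivative
  of the congruent matrix into \<open>transpose g ** S ** g\<close>, with S the left side of the
  equation; a congruence by an invertible g kills only 0.\<close>

lemma constant_congruence_iff:
  fixes g M :: "'a^'n^'n" and i
  assumes "invertible g"
  defines "X \<equiv> map_matrix (d i) g ** matrix_inv g"
  shows "transpose X ** M + M ** X + map_matrix (d i) M = 0 \<longleftrightarrow>
    map_matrix (d i) (transpose g ** M ** g) = 0" (is "?S = 0 \<longleftrightarrow> ?T = 0")
proof -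
  have inv: "g ** matrix_inv g = mat 1" "matrix_inv g ** g = mat 1"
    using assms(1) by (simp_all add: matrix_inv_inverse)
  have Xg: "X ** g = map_matrix (d i) g"
    by (simp add: X_def inv flip: matrix_mul_assoc)
  have "?T = transpose (X ** g) ** M ** g + transpose g ** map_matrix (d i) M ** g
      + transpose g ** M ** (X ** g)"
    by (simp add: d_matrix_mult Xg d_transpose matrix_add_rdistrib matrix_mul_assoc)
  also have "\<dots> = transpose g ** ?S ** g"
    by (simp add: matrix_transpose_mul matrix_add_rdistrib matrix_add_ldistrib matrix_mul_assoc
        algebra_simps)
  finally have T: "?T = transpose g ** ?S ** g" .
  have "transpose (matrix_inv g) ** transpose g = mat 1"
    by (simp add: inv transpose_mat flip: matrix_transpose_mul)
  then have "?S = transpose (matrix_inv g) ** ?T ** matrix_inv g"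
    unfolding T by (simp add: matrix_mul_assoc) (simp add: inv flip: matrix_mul_assoc)
  then show ?thesis
    using T by auto
qed

text \<open>The product rule gives dm = dg u + g du, while the left side of the equation is dg u; so
  the equation says g du = 0.\<close>

lemma constant_inverse_image_iff:
  assumes "invertible g" and "m = g *v u"
  shows "(map_matrix (d i) g ** matrix_inv g) *v m = map_vector (d i) m \<longleftrightarrow>
    map_vector (d i) u = 0"
proof -
  have inv: "g ** matrix_inv g = mat 1" "matrix_inv g ** g = mat 1"
    using assms(1) by (simp_all add: matrix_inv_inverse)
  have "(map_matrix (d i) g ** matrix_inv g) *v m = map_matrix (d i) g *v u"
    by (simp add: assms(2) matrix_vector_mul_assoc flip: matrix_mul_assoc) (simp add: inv)
  moreover have "map_vector (d i) m = map_matrix (d i) g *v u + g *v map_vector (d i) u"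
    by (simp add: assms(2) d_matrix_vector_mult)
  moreover have "g *v w = 0 \<longleftrightarrow> w = 0" for w
    by (metis inv(2) matrix_vector_mul_assoc matrix_vector_mul_lid matrix_vector_mult_0_right)
  ultimately show ?thesis
    by simp
qed

text \<open>Splits the group element, so that the effects of h and of g can be studied
  separately.\<close>

lemma tau_factor: "tau d h g V = tau d 1 g (tau d h (mat 1) V)"
  by (cases V) (simp add: mat_def algebra_simps)

section \<open>The substitution u = h v\<close>

context
  fixes h :: 'a
  assumes h: "h \<noteq> 0"
begin

lemma log_gradient_tau_left:
  assumes "disc V \<noteq> 0"
  defines "V' \<equiv> tau d h (mat 1) V"
  shows "a_d d V' / disc V' = a_d d V / disc V - d 1 h / h"
    and "b_d d V' / disc V' = b_d d V / disc V - d 2 h / h"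
proof -
  obtain A B C a b c where V: "V = (A, B, C, a, b, c)"
    by (metis prod_cases6)
  have "a_d d V' = h\<^sup>2 * a_d d V - h * d 1 h * disc V"
    unfolding V'_def V by (simp add: mat_def) algebra
  moreover have "b_d d V' = h\<^sup>2 * b_d d V - h * d 2 h * disc V"
    unfolding V'_def V by (simp add: mat_def) algebra
  moreover have "disc V' = h\<^sup>2 * disc V"
    by (simp add: V'_def disc_tau_left)
  ultimately show "a_d d V' / disc V' = a_d d V / disc V - d 1 h / h"
    "b_d d V' / disc V' = b_d d V / disc V - d 2 h / h"
    using assms(1) h by (simp_all add: diff_divide_distrib power2_eq_square)
qed

text \<open>The new operator is v -> L(h v). If (p, q) is the logarithmic gradient of w, the shifted
  pair is that of w / h, and L w divided by w / h is h times L w / w. The computation is the formal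
  version for arbitrary p, q.\<close>

lemma riccati_tau_left:
  "riccati d (tau d h (mat 1) V) (p - d 1 h / h) (q - d 2 h / h) = h * riccati d V p q"
proof -
  obtain A B C a b c where V: "V = (A, B, C, a, b, c)"
    by (metis prod_cases6)
  show ?thesis
    unfolding V using h
    by (simp add: mat_def d_divide commute power2_eq_square field_simps)
qed

lemma gamma0_tau_left:
  assumes "disc V \<noteq> 0"
  shows "gamma0 d (tau d h (mat 1) V) = h * gamma0 d V"
  using riccati_tau_left by (simp add: gamma0_eq_riccati log_gradient_tau_left[OF assms])

lemma M_d_tau_left:
  assumes "disc V \<noteq> 0"
  shows "M_d d (tau d h (mat 1) V) = M_d d V"
proof -
  obtain A B C a b c where V: "V = (A, B, C, a, b, c)"
    by (metis prod_cases6)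
  obtain a' b' c' where V': "tau d h (mat 1) V = (h * A, h * B, h * C, a', b', c')"
    by (simp add: V mat_def)
  show ?thesis
    using gamma0_tau_left[OF assms] h unfolding V' unfolding V
    by (auto simp: vec_eq_iff map_matrix_def forall_2 simp del: gamma0.simps)
qed

text \<open>The shift of (p, q) cancels the logarithmic derivative of the factor h gained by
  \<open>gamma0\<close>.\<close>

lemma m_d_tau_left:
  assumes "disc V \<noteq> 0" and "gamma0 d V \<noteq> 0"
  shows "m_d d (tau d h (mat 1) V) = m_d d V"
proof -
  have "inverse (h * gamma0 d V) * d i (h * gamma0 d V) =
      d i h / h + inverse (gamma0 d V) * d i (gamma0 d V)" for i
    using assms(2) h by (simp add: field_simps)
  then show ?thesis
    by (simp add: m_d_def gamma0_tau_left[OF assms(1)] log_gradient_tau_left[OF assms(1)] del: d_mult)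
qed

text \<open>The shift is a logarithmic gradient, which is closed because the derivations
  commute.\<close>

lemma closed_tau_left:
  assumes "disc V \<noteq> 0" and "d 2 (a_d d V / disc V) = d 1 (b_d d V / disc V)"
  defines "V' \<equiv> tau d h (mat 1) V"
  shows "d 2 (a_d d V' / disc V') = d 1 (b_d d V' / disc V')"
  using assms(2) h
  by (simp add: V'_def log_gradient_tau_left[OF assms(1)] d_divide commute mult.commute)

end

section \<open>The change of derivations\<close>

context
  fixes g :: "'a^2^2" and \<delta> :: "'a derivs"
  assumes g: "g \<in> GL_d d"
  defines "\<delta> \<equiv> transform_derivs g d"
begin

lemma invertible: "invertible g"
  and d2_row1: "d 2 (g$1$j) = d 1 (g$2$j)"
  using g by (simp_all add: GL_d_def)

lemma det_nonzero: "det g \<noteq> 0"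
  using invertible by (simp add: invertible_det_nz)

lemma d_eq: "d i u = g$i$1 * \<delta> 1 u + g$i$2 * \<delta> 2 u"
proof -
  have "(\<chi> j. \<delta> j u) = matrix_inv g *v (\<chi> j. d j u)"
    by (simp add: \<delta>_def transform_derivs_def matrix_vector_mult_def)
  then have "g *v (\<chi> j. \<delta> j u) = (\<chi> j. d j u)"
    using invertible by (simp add: matrix_vector_mul_assoc matrix_inv_inverse)
  then show ?thesis
    by (simp add: vec_eq_iff matrix_vector_mult_def sum_2)
qed

text \<open>Cramer's rule: formulas free of \<open>matrix_inv\<close> and of division.\<close>

lemma det_mult_delta:
  "det g * \<delta> 1 u = g$2$2 * d 1 u - g$1$2 * d 2 u"
  "det g * \<delta> 2 u = g$1$1 * d 2 u - g$2$1 * d 1 u"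
  unfolding d_eq[of _ u] det_2 by algebra+

lemma delta_constant: "u \<in> constant_field d \<Longrightarrow> \<delta> i u = 0"
  by (simp add: constant_iff \<delta>_def transform_derivs_def)

lemma log_gradient_tau_right:
  assumes "disc V \<noteq> 0"
  defines "V' \<equiv> tau d 1 g V"
  shows "a_d d V / disc V = g$1$1 * (a_d \<delta> V' / disc V') + g$1$2 * (b_d \<delta> V' / disc V')"
    and "b_d d V / disc V = g$2$1 * (a_d \<delta> V' / disc V') + g$2$2 * (b_d \<delta> V' / disc V')"
proof -
  obtain A B C a b c where V: "V = (A, B, C, a, b, c)"
    by (metis prod_cases6)
  \<comment> \<open>\<open>det g * \<delta> i u\<close> is polynomial in \<open>g\<close> and \<open>d\<close>, so multiplying by \<open>det g\<close> leaves
    ring identities.\<close>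
  have 1: "det g * (A * \<delta> 1 C - \<delta> 1 A * C + B * \<delta> 2 C - \<delta> 2 B * C - b * B + 2 * a * C) =
      A * (det g * \<delta> 1 C) - (det g * \<delta> 1 A) * C + B * (det g * \<delta> 2 C) - (det g * \<delta> 2 B) * C
        + det g * (- b * B + 2 * a * C)" for A B C a b
    by algebra
  have 2: "det g * (\<delta> 1 A * B - A * \<delta> 1 B + \<delta> 2 A * C - A * \<delta> 2 C - a * B + 2 * b * A) =
      (det g * \<delta> 1 A) * B - A * (det g * \<delta> 1 B) + (det g * \<delta> 2 A) * C - A * (det g * \<delta> 2 C)
        + det g * (- a * B + 2 * b * A)" for A B C a b
    by algebra
  have 3: "det g * (g$i$1 * x + g$i$2 * y) = g$i$1 * (det g * x) + g$i$2 * (det g * y)" for i x y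
    by algebra
  note expand = 3 V'_def V tau.simps a_d.simps b_d.simps 1 2 det_mult_delta
  \<comment> \<open>Of the three factors \<open>det g\<close>, one clears the denominators of
    \<open>\<delta>\<close>; the other two match the scaling of \<open>disc\<close>.\<close>
  have 4: "det g * (g$1$1 * a_d \<delta> V' + g$1$2 * b_d \<delta> V') = (det g)^3 * a_d d V"
    unfolding expand unfolding d_add d_mult d_power2 d_numeral d_0 d_1 d2_row1 det_2 by algebra
  have 5: "det g * (g$2$1 * a_d \<delta> V' + g$2$2 * b_d \<delta> V') = (det g)^3 * b_d d V"
    unfolding expand unfolding d_add d_mult d_power2 d_numeral d_0 d_1 d2_row1 det_2 by algebra
  have 6: "disc V' = (det g)\<^sup>2 * disc V"
    by (simp add: V'_def disc_tau_right)
  have "g$1$1 * a_d \<delta> V' + g$1$2 * b_d \<delta> V' = (det g)\<^sup>2 * a_d d V"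
    "g$2$1 * a_d \<delta> V' + g$2$2 * b_d \<delta> V' = (det g)\<^sup>2 * b_d d V"
    using 4 5 det_nonzero by (simp_all add: power2_eq_square power3_eq_cube)
  then show "a_d d V / disc V = g$1$1 * (a_d \<delta> V' / disc V') + g$1$2 * (b_d \<delta> V' / disc V')"
    "b_d d V / disc V = g$2$1 * (a_d \<delta> V' / disc V') + g$2$2 * (b_d \<delta> V' / disc V')"
    using assms(1) det_nonzero by (simp_all add: 6 flip: add_divide_distrib)
qed

text \<open>If (p, q) is the logarithmic gradient of w under \<open>d\<close>, then (P, Q) is the
  one under \<open>\<delta>\<close>, and both sides are L w / w. For general pairs, closedness
  stands in for the existence of w.\<close>

lemma riccati_tau_right:
  assumes p: "p = g$1$1 * P + g$1$2 * Q" and q: "q = g$2$1 * P + g$2$2 * Q"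
    and closed: "d 2 p = d 1 q"
  shows "riccati \<delta> (tau d 1 g V) P Q = riccati d V p q"
proof -
  obtain A B C a b c where V: "V = (A, B, C, a, b, c)"
    by (metis prod_cases6)
  \<comment> \<open>The columns of g are closed, so the curl of the pair only picks up the factor
    \<open>det g\<close>.\<close>
  have "d 2 p - d 1 q = det g * (\<delta> 2 P - \<delta> 1 Q)"
    unfolding p q by (simp add: d2_row1 d_eq[of _ P] d_eq[of _ Q] det_2 algebra_simps)
  with closed det_nonzero have Q1: "\<delta> 1 Q = \<delta> 2 P"
    by simp
  show ?thesis
    unfolding V p q tau.simps riccati.simps d_add d_mult d2_row1 d_eq[of _ P] d_eq[of _ Q] Q1
      d_1 d_0
    by algebra
qed

lemma gamma0_tau_right:
  assumes "disc V \<noteq> 0" and "d 2 (a_d d V / disc V) = d 1 (b_d d V / disc V)"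
  shows "gamma0 \<delta> (tau d 1 g V) = gamma0 d V"
  unfolding gamma0_eq_riccati
  by (rule riccati_tau_right[OF log_gradient_tau_right[OF assms(1)] assms(2)])

lemma congruence_M_d:
  assumes "(2::'a) \<noteq> 0" and "disc V \<noteq> 0"
    and "d 2 (a_d d V / disc V) = d 1 (b_d d V / disc V)"
  shows "transpose g ** M_d d V ** g = M_d \<delta> (tau d 1 g V)"
proof -
  obtain A B C a b c where V: "V = (A, B, C, a, b, c)"
    by (metis prod_cases6)
  obtain A' B' C' a' b' c' where V': "tau d 1 g V = (A', B', C', a', b', c')"
    by (metis prod_cases6)
  \<comment> \<open>\<open>B / 2\<close> is kept as an atom: it is the off-diagonal entry of the
    symmetric matrix.\<close>
  have "A' = A * (g$1$1)\<^sup>2 + 2 * (B / 2) * g$1$1 * g$2$1 + C * (g$2$1)\<^sup>2"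
    "B' / 2 = A * g$1$1 * g$1$2 + (B / 2) * (g$1$1 * g$2$2 + g$1$2 * g$2$1) + C * g$2$1 * g$2$2"
    "C' = A * (g$1$2)\<^sup>2 + 2 * (B / 2) * g$1$2 * g$2$2 + C * (g$2$2)\<^sup>2"
    using V' assms(1) by (auto simp: V field_simps)
  moreover have "gamma0 \<delta> (A', B', C', a', b', c') = gamma0 d V"
    using gamma0_tau_right[OF assms(2,3)] by (simp only: V')
  ultimately show ?thesis
    unfolding V' unfolding V M_d.simps
    by (simp only:) (simp add: vec_eq_iff map_matrix_def forall_2 matrix_matrix_mult_def transpose_def
        sum_2 algebra_simps power2_eq_square
        del: gamma0.simps times_divide_eq_left times_divide_eq_right)
qed

section \<open>Both directions of the criterion for h = 1\<close>

lemma solution_if_constant_coeffs: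
  assumes "(2::'a) \<noteq> 0" and "disc V \<noteq> 0"
    and "d 2 (a_d d V / disc V) = d 1 (b_d d V / disc V)"
    and "constant_coeffs d (tau d 1 g V)"
  shows "transpose (map_matrix (d i) g ** matrix_inv g) ** M_d d V
         + M_d d V ** (map_matrix (d i) g ** matrix_inv g)
         + map_matrix (d i) (M_d d V) = 0
       \<and> (map_matrix (d i) g ** matrix_inv g) *v m_d d V = map_vector (d i) (m_d d V)"
proof -
  obtain A B C a b c where V': "tau d 1 g V = (A, B, C, a, b, c)"
    by (metis prod_cases6)
  define p q where "p = a_d \<delta> (tau d 1 g V) / disc (tau d 1 g V)"
    and "q = b_d \<delta> (tau d 1 g V) / disc (tau d 1 g V)"
  have const: "{A, B, C, a, b, c} \<subseteq> constant_field d"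
    using assms(4) by (simp add: V')
  then have pq: "p \<in> constant_field d" "q \<in> constant_field d"
    by (auto simp: p_def q_def V' delta_constant intro!: constant_intros)
  have \<gamma>': "gamma0 \<delta> (tau d 1 g V) \<in> constant_field d"
    unfolding gamma0_eq_riccati p_def[symmetric] q_def[symmetric]
    using const pq by (auto simp: V' delta_constant intro!: constant_intros)
  \<comment> \<open>This removes the logarithmic derivative from \<open>m_d d V\<close>, leaving g
    applied to (p, q).\<close>
  then have \<gamma>: "d i (gamma0 d V) = 0" for i
    by (simp add: gamma0_tau_right[OF assms(2,3)] constant_iff)
  have "M_d \<delta> (tau d 1 g V) $ i $ j \<in> constant_field d" for i j
    using const \<gamma>' exhaust_2[of i] exhaust_2[of j] unfolding V'
    by (auto simp: map_matrix_def simp del: gamma0.simps intro!: constant_intros)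
  then have "map_matrix (d i) (transpose g ** M_d d V ** g) = 0"
    unfolding congruence_M_d[OF assms(1-3)] by (simp add: vec_eq_iff map_matrix_def constant_iff)
  moreover have "m_d d V = g *v vector [p, q]"
    by (simp add: m_d_def \<gamma> log_gradient_tau_right[OF assms(2)] p_def q_def
        vec_eq_iff forall_2 matrix_vector_mult_def sum_2)
  moreover have "(vector [p, q] :: 'a^2) $ j \<in> constant_field d" for j
    using pq exhaust_2[of j] by auto
  then have "map_vector (d i) (vector [p, q] :: 'a^2) = 0"
    by (simp add: vec_eq_iff map_vector_def constant_iff)
  ultimately show ?thesis
    using constant_congruence_iff[OF invertible] constant_inverse_image_iff[OF invertible] by simp
qed

lemma constant_coeffs_if_solution:
  assumes "(2::'a) \<noteq> 0" and "disc V \<noteq> 0"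
    and "d 2 (a_d d V / disc V) = d 1 (b_d d V / disc V)"
    and \<gamma>: "gamma0 d V = 1"
    and sol: "\<And>i. transpose (map_matrix (d i) g ** matrix_inv g) ** M_d d V
         + M_d d V ** (map_matrix (d i) g ** matrix_inv g)
         + map_matrix (d i) (M_d d V) = 0
       \<and> (map_matrix (d i) g ** matrix_inv g) *v m_d d V = map_vector (d i) (m_d d V)"
  shows "constant_coeffs d (tau d 1 g V)"
proof -
  obtain A B C a b c where V': "tau d 1 g V = (A, B, C, a, b, c)"
    by (metis prod_cases6)
  define p q where "p = a_d \<delta> (tau d 1 g V) / disc (tau d 1 g V)"
    and "q = b_d \<delta> (tau d 1 g V) / disc (tau d 1 g V)"
  have \<gamma>': "gamma0 \<delta> (A, B, C, a, b, c) = 1"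
    using gamma0_tau_right[OF assms(2,3)] \<gamma> by (simp only: V')
  have "map_matrix (d i) (M_d \<delta> (tau d 1 g V)) = 0" for i
    using sol[of i] constant_congruence_iff[OF invertible, of i "M_d d V"]
    unfolding congruence_M_d[OF assms(1-3)] by simp
  then have "M_d \<delta> (tau d 1 g V) $ i $ j \<in> constant_field d" for i j
    by (simp add: vec_eq_iff map_matrix_def constant_iff)
  from this[of 1 1] this[of 1 2] this[of 2 2]
  have A: "A \<in> constant_field d" and B2: "B / 2 \<in> constant_field d" and C: "C \<in> constant_field d"
    unfolding V' by (simp_all add: map_matrix_def \<gamma>' del: gamma0.simps)
  have B: "B \<in> constant_field d"
    using constant_mult[OF B2 constant_numeral[of "num.Bit0 num.One"]] assms(1) by simp
  have "m_d d V = g *v vector [p, q]"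
    by (simp add: m_d_def \<gamma> log_gradient_tau_right[OF assms(2)] p_def q_def
        vec_eq_iff forall_2 matrix_vector_mult_def sum_2)
  then have "map_vector (d i) (vector [p, q] :: 'a^2) = 0" for i
    using sol[of i] constant_inverse_image_iff[OF invertible] by simp
  then have p: "p \<in> constant_field d" and q: "q \<in> constant_field d"
    by (simp_all add: vec_eq_iff forall_2 map_vector_def constant_iff)
  have D: "disc (A, B, C, a, b, c) \<noteq> 0"
    using disc_tau_right[of d g V] assms(2) det_nonzero by (simp add: V' del: disc.simps)
  \<comment> \<open>Derivatives of the constants A, B, C drop out, leaving a linear system for a, b
    with determinant \<open>- disc (A, B, C, a, b, c)\<close>; Cramer's rule solves it
    below.\<close>
  have a_d: "p * disc (A, B, C, a, b, c) = 2 * a * C - b * B"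
    and b_d: "q * disc (A, B, C, a, b, c) = 2 * b * A - a * B"
    using D A B C by (simp_all add: p_def q_def V' delta_constant)
  have "disc (A, B, C, a, b, c) * a = disc (A, B, C, a, b, c) * - (2 * A * p + B * q)"
    "disc (A, B, C, a, b, c) * b = disc (A, B, C, a, b, c) * - (2 * C * q + B * p)"
    using a_d b_d unfolding disc.simps by algebra+
  then have "a = - (2 * A * p + B * q)" "b = - (2 * C * q + B * p)"
    using D by simp_all
  then have a: "a \<in> constant_field d" and b: "b \<in> constant_field d"
    using A B C p q by (auto intro!: constant_intros)
  \<comment> \<open>With p and q constant, the normalization of \<open>gamma0\<close> determines c,
    which enters with coefficient 1.\<close>
  have "riccati \<delta> (A, B, C, a, b, c) p q = 1"
    using \<gamma>' unfolding gamma0_eq_riccati p_def q_def V' by simp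
  then have "c = 1 - (A * p\<^sup>2 + B * (p * q) + C * q\<^sup>2 + a * p + b * q)"
    using p q by (simp add: delta_constant algebra_simps)
  then have "c \<in> constant_field d"
    using A B C a b p q by (auto intro!: constant_intros)
  with A B C a b show ?thesis
    by (simp add: V')
qed

end

end

theorem corollary3p2:
  fixes d :: "'a::field derivs" and V :: "'a coeffs"
  assumes "CHAR('a) \<noteq> 2"
    and "\<And>i. derivation (d i)"
    and "\<And>u. d 1 (d 2 u) = d 2 (d 1 u)"
    and "lin_indep_derivs d"
    and "disc V \<noteq> 0"
    and "d 2 (a_d d V / disc V) = d 1 (b_d d V / disc V)"
    and "gamma0 d V \<noteq> 0"
  shows "(\<exists>\<delta> V1. G_equivalent (d, V) (\<delta>, V1) \<and> constant_coeffs d V1) \<longleftrightarrow>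
    (\<exists>g \<in> GL_d d. \<forall>i.
       transpose (map_matrix (d i) g ** matrix_inv g) ** M_d d V
         + M_d d V ** (map_matrix (d i) g ** matrix_inv g)
         + map_matrix (d i) (M_d d V) = 0
       \<and> (map_matrix (d i) g ** matrix_inv g) *v m_d d V = map_vector (d i) (m_d d V))"
    (is "?equiv \<longleftrightarrow> (\<exists>g \<in> GL_d d. \<forall>i. ?sol g i)")
proof -
  interpret commuting_derivations d
    using assms(2,3) by unfold_locales
  have two: "(2::'a) \<noteq> 0"
  proof
    assume "(2::'a) = 0"
    then have "CHAR('a) dvd 2"
      using of_nat_eq_0_iff_char_dvd[of 2, where 'a = 'a] by simp
    then show False
      using assms(1) two_is_prime_nat
      by (metis CHAR_not_1' One_nat_def prime_nat_iff)
  qed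
  show ?thesis
  proof
    assume ?equiv
    then obtain h g where h: "h \<noteq> 0" and g: "g \<in> GL_d d"
      and const: "constant_coeffs d (tau d h g V)"
      unfolding G_equivalent.simps by blast
    \<comment> \<open>W absorbs h and has the same \<open>M_d\<close> and \<open>m_d\<close> as V,
      so a solution of the system for W is one for V.\<close>
    define W where "W = tau d h (mat 1) V"
    have "disc W \<noteq> 0" "d 2 (a_d d W / disc W) = d 1 (b_d d W / disc W)"
      unfolding W_def using h assms(5) closed_tau_left[OF h assms(5,6)]
      by (simp_all add: disc_tau_left)
    moreover have "constant_coeffs d (tau d 1 g W)"
      using const by (simp add: W_def flip: tau_factor)
    ultimately have "?sol g i" for i
      using solution_if_constant_coeffs[OF g two, of W i]
      unfolding W_def M_d_tau_left[OF h assms(5)] m_d_tau_left[OF h assms(5,7)] by blast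
    with g show "\<exists>g \<in> GL_d d. \<forall>i. ?sol g i"
      by blast
  next
    assume "\<exists>g \<in> GL_d d. \<forall>i. ?sol g i"
    then obtain g where g: "g \<in> GL_d d" and sol: "\<And>i. ?sol g i"
      by blast
    \<comment> \<open>\<open>gamma0\<close> is multiplied by h, so this choice gives
      \<open>gamma0 d W = 1\<close> without changing the system.\<close>
    define h where "h = 1 / gamma0 d V"
    have h: "h \<noteq> 0"
      using assms(7) by (simp add: h_def)
    define W where "W = tau d h (mat 1) V"
    have "disc W \<noteq> 0" "d 2 (a_d d W / disc W) = d 1 (b_d d W / disc W)" "gamma0 d W = 1"
      unfolding W_def using h assms(5,7) closed_tau_left[OF h assms(5,6)]
      by (simp_all add: disc_tau_left gamma0_tau_left h_def)
    moreover have "M_d d W = M_d d V" "m_d d W = m_d d V"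
      unfolding W_def using M_d_tau_left[OF h assms(5)] m_d_tau_left[OF h assms(5,7)] .
    ultimately have "constant_coeffs d (tau d 1 g W)"
      using constant_coeffs_if_solution[OF g two, of W] sol by simp
    then have "constant_coeffs d (tau d h g V)"
      by (simp add: W_def flip: tau_factor)
    with g h show ?equiv
      unfolding G_equivalent.simps by blast
  qed
qed

end
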